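(* Let $N:\mathfrak g\to\mathfrak g$ be a Nijenhuis operator on a compatible Hom-Lie triple system $(\mathfrak g,[-,-,-]^1_{\mathfrak g},[-,-,-]^2_{\mathfrak g},\alpha_{\mathfrak g})$. For $i=1,2$ and $a,b,c\in\mathfrak g$ set $$\mu_i(a,b,c)=[Na,b,c]^i_{\mathfrak g}+[a,Nb,c]^i_{\mathfrak g}+[a,b,Nc]^i_{\mathfrak g}-N[a,b,c]^i_{\mathfrak g},$$ $$\omega_i(a,b,c)=[Na,Nb,c]^i_{\mathfrak g}+[Na,b,Nc]^i_{\mathfrak g}+[a,Nb,Nc]^i_{\mathfrak g}-N\mu_i(a,b,c).$$ Then $((\mu_1,\mu_2),(\omega_1,\omega_2))$ generates a trivial linear deformation of the compatible Hom-Lie triple system $(\mathfrak g,[-,-,-]^1_{\mathfrak g},[-,-,-]^2_{\mathfrak g},\alpha_{\mathfrak g})$.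
   Context: All vector spaces and (multi)linear maps are over a field $\mathbb K$ of characteristic zero. Write $\alpha=\alpha_{\mathfrak g}$. A Hom-Lie triple system $(\mathfrak g,[-,-,-],\alpha)$ is a vector space $\mathfrak g$ with a trilinear operation and a linear map $\alpha$ such that $\alpha([x,y,z])=[\alpha(x),\alpha(y),\alpha(z)]$, $[x,y,z]+[y,x,z]=0$, $[x,y,z]+[z,x,y]+[y,z,x]=0$, and $[\alpha(a),\alpha(b),[x,y,z]]=[[a,b,x],\alpha(y),\alpha(z)]+[\alpha(x),[a,b,y],\alpha(z)]+[\alpha(x),\alpha(y),[a,b,z]]$ for all $a,b,x,y,z\in\mathfrak g$. A compatible Hom-Lie triple system $(\mathfrak g,[-,-,-]^1,[-,-,-]^2,\alpha)$ consists of two Hom-Lie triple systems $(\mathfrak g,[-,-,-]^1,\alpha)$, $(\mathfrak g,[-,-,-]^2,\alpha)$ such that for all $a,b,x,y,z$: $[\alpha(a),\alpha(b),[x,y,z]^2]^1+[\alpha(a),\alpha(b),[x,y,z]^1]^2=[[a,b,x]^1,\alpha(y),\alpha(z)]^2+[[a,b,x]^2,\alpha(y),\alpha(z)]^1+[\alpha(x),[a,b,y]^1,\alpha(z)]^2+[\alpha(x),[a,b,y]^2,\alpha(z)]^1+[\alpha(x),\alpha(y),[a,b,z]^1]^2+[\alpha(x),\alpha(y),[a,b,z]^2]^1.$ A Nijenhuis operator on a compatible Hom-Lie triple system is a linear map $N:\mathfrak g\to\mathfrak g$ which is a Nijenhuis operator for both Hom-Lie triple systems, i.e. $\alpha\circ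 N=N\circ\alpha$ and, for $i=1,2$ and all $a,b,c$, $[Na,Nb,Nc]^i=N([Na,Nb,c]^i+[Na,b,Nc]^i+[a,Nb,Nc]^i)-N^2([Na,b,c]^i+[a,Nb,c]^i+[a,b,Nc]^i)+N^3[a,b,c]^i.$ A 2-cochain in $\mathcal C^2_{\mathrm{cHLts}}(\mathfrak g,\mathfrak g)$ is a pair $(\mu_1,\mu_2)$ of trilinear maps $\mathfrak g^3\to\mathfrak g$, each satisfying $\alpha(\mu(a,b,c))=\mu(\alpha(a),\alpha(b),\alpha(c))$, $\mu(a,b,c)+\mu(b,a,c)=0$ and $\mu(a,b,c)+\mu(b,c,a)+\mu(c,a,b)=0$. For two 2-cochains $(\mu_1,\mu_2),(\omega_1,\omega_2)$ put $[a,b,c]^i_t=[a,b,c]^i_{\mathfrak g}+t\mu_i(a,b,c)+t^2\omega_i(a,b,c)$, $i=1,2$. If for all $t$ the quadruple $(\mathfrak g,[-,-,-]^1_t,[-,-,-]^2_t,\alpha)$ is a compatible Hom-Lie triple system, $((\mu_1,\mu_2),(\omega_1,\omega_2))$ is said to generate a linear deformation of $\mathfrak g$. Linear deformations $([-,-,-]^1_t,[-,-,-]^2_t)$ and $([-,-,-]'^1_t,[-,-,-]'^2_t)$ are equivalent if there is a linear map $N:\mathfrak g\to\mathfrak g$ such that $N_t=\mathrm{Id}_{\mathfrak g}+tN$ satisfies $\alpha\circ N_t=N_t\circ\alpha$ and $N_t[a,b,c]^i_t=[N_ta,N_tb,N_tc]'^i_t$ for all $a,b,c$ and $i=1,2$.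 A linear deformation is trivial if it is equivalent to the undeformed one $([-,-,-]^1_{\mathfrak g},[-,-,-]^2_{\mathfrak g})$ (the latter playing the role of the primed brackets). *)

theory Defs
  imports Complex_Main
begin

text \<open>
  The ground field is a type of class \<open>field_char_0\<close>, and the underlying vector space
  is a type \<open>'v\<close> of arbitrary dimension with scalar multiplication \<open>scale\<close>.
\<close>

definition trilinear :: "('k::field_char_0 \<Rightarrow> 'v::ab_group_add \<Rightarrow> 'v) \<Rightarrow> ('v \<Rightarrow> 'v \<Rightarrow> 'v \<Rightarrow> 'v) \<Rightarrow> bool"
  where "trilinear scale m \<longleftrightarrow>
    (\<forall>b c. Vector_Spaces.linear scale scale (\<lambda>a. m a b c)) \<and>
    (\<forall>a c. Vector_Spaces.linear scale scale (\<lambda>b. m a b c)) \<and>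
    (\<forall>a b. Vector_Spaces.linear scale scale (\<lambda>c. m a b c))"

locale hom_lie_triple_system = vector_space scale
  for scale :: "'k::field_char_0 \<Rightarrow> 'v::ab_group_add \<Rightarrow> 'v" +
  fixes br :: "'v \<Rightarrow> 'v \<Rightarrow> 'v \<Rightarrow> 'v" and \<alpha> :: "'v \<Rightarrow> 'v"
  assumes trilinear_br: "trilinear scale br"
    and linear_twist: "Vector_Spaces.linear scale scale \<alpha>"
    and multiplicative: "\<alpha> (br x y z) = br (\<alpha> x) (\<alpha> y) (\<alpha> z)"
    and skew: "br x y z + br y x z = 0"
    and cyclic: "br x y z + br z x y + br y z x = 0"
    and fundamental: "br (\<alpha> a) (\<alpha> b) (br x y z) =
      br (br a b x) (\<alpha> y) (\<alpha> z) + br (\<alpha> x) (br a b y) (\<alpha> z) + br (\<alpha> x) (\<alpha> y) (br a b z)"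

locale compatible_hom_lie_triple_system =
  first: hom_lie_triple_system scale br1 \<alpha> + second: hom_lie_triple_system scale br2 \<alpha>
  for scale :: "'k::field_char_0 \<Rightarrow> 'v::ab_group_add \<Rightarrow> 'v"
    and br1 br2 :: "'v \<Rightarrow> 'v \<Rightarrow> 'v \<Rightarrow> 'v" and \<alpha> :: "'v \<Rightarrow> 'v" +
  assumes compatible:
    "br1 (\<alpha> a) (\<alpha> b) (br2 x y z) + br2 (\<alpha> a) (\<alpha> b) (br1 x y z) =
       br2 (br1 a b x) (\<alpha> y) (\<alpha> z) + br1 (br2 a b x) (\<alpha> y) (\<alpha> z)
     + br2 (\<alpha> x) (br1 a b y) (\<alpha> z) + br1 (\<alpha> x) (br2 a b y) (\<alpha> z)
     + br2 (\<alpha> x) (\<alpha> y) (br1 a b z) + br1 (\<alpha> x) (\<alpha> y) (br2 a b z)"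

definition nijenhuis_operator ::
    "('k::field_char_0 \<Rightarrow> 'v::ab_group_add \<Rightarrow> 'v) \<Rightarrow> ('v \<Rightarrow> 'v \<Rightarrow> 'v \<Rightarrow> 'v) \<Rightarrow> ('v \<Rightarrow> 'v) \<Rightarrow> ('v \<Rightarrow> 'v) \<Rightarrow> bool"
  where "nijenhuis_operator scale br \<alpha> N \<longleftrightarrow>
    Vector_Spaces.linear scale scale N \<and> \<alpha> \<circ> N = N \<circ> \<alpha> \<and>
    (\<forall>a b c. br (N a) (N b) (N c) =
        N (br (N a) (N b) c + br (N a) b (N c) + br a (N b) (N c))
      - (N ^^ 2) (br (N a) b c + br a (N b) c + br a b (N c))
      + (N ^^ 3) (br a b c))"

definition compatible_nijenhuis_operator ::
    "('k::field_char_0 \<Rightarrow> 'v::ab_group_add \<Rightarrow> 'v) \<Rightarrow> ('v \<Rightarrow> 'v \<Rightarrow> 'v \<Rightarrow> 'v) \<Rightarrow> ('v \<Rightarrow> 'v \<Rightarrow> 'v \<Rightarrow> 'v) \<Rightarrow>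
     ('v \<Rightarrow> 'v) \<Rightarrow> ('v \<Rightarrow> 'v) \<Rightarrow> bool"
  where "compatible_nijenhuis_operator scale br1 br2 \<alpha> N \<longleftrightarrow>
    nijenhuis_operator scale br1 \<alpha> N \<and> nijenhuis_operator scale br2 \<alpha> N"

definition hom_lts_cochain2 ::
    "('k::field_char_0 \<Rightarrow> 'v::ab_group_add \<Rightarrow> 'v) \<Rightarrow> ('v \<Rightarrow> 'v) \<Rightarrow> ('v \<Rightarrow> 'v \<Rightarrow> 'v \<Rightarrow> 'v) set"
  where "hom_lts_cochain2 scale \<alpha> = {\<mu>. trilinear scale \<mu> \<and>
    (\<forall>a b c. \<alpha> (\<mu> a b c) = \<mu> (\<alpha> a) (\<alpha> b) (\<alpha> c)) \<and>
    (\<forall>a b c. \<mu> a b c + \<mu> b a c = 0) \<and>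
    (\<forall>a b c. \<mu> a b c + \<mu> b c a + \<mu> c a b = 0)}"

definition compatible_cochain2 ::
    "('k::field_char_0 \<Rightarrow> 'v::ab_group_add \<Rightarrow> 'v) \<Rightarrow> ('v \<Rightarrow> 'v) \<Rightarrow>
     (('v \<Rightarrow> 'v \<Rightarrow> 'v \<Rightarrow> 'v) \<times> ('v \<Rightarrow> 'v \<Rightarrow> 'v \<Rightarrow> 'v)) set"
  where "compatible_cochain2 scale \<alpha> = hom_lts_cochain2 scale \<alpha> \<times> hom_lts_cochain2 scale \<alpha>"

definition deformed_bracket ::
    "('k::field_char_0 \<Rightarrow> 'v::ab_group_add \<Rightarrow> 'v) \<Rightarrow> ('v \<Rightarrow> 'v \<Rightarrow> 'v \<Rightarrow> 'v) \<Rightarrow> ('v \<Rightarrow> 'v \<Rightarrow> 'v \<Rightarrow> 'v) \<Rightarrow>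
     ('v \<Rightarrow> 'v \<Rightarrow> 'v \<Rightarrow> 'v) \<Rightarrow> 'k \<Rightarrow> 'v \<Rightarrow> 'v \<Rightarrow> 'v \<Rightarrow> 'v"
  where "deformed_bracket scale br \<mu> \<omega> t a b c =
    br a b c + scale t (\<mu> a b c) + scale (t ^ 2) (\<omega> a b c)"

definition generates_linear_deformation ::
    "('k::field_char_0 \<Rightarrow> 'v::ab_group_add \<Rightarrow> 'v) \<Rightarrow> ('v \<Rightarrow> 'v \<Rightarrow> 'v \<Rightarrow> 'v) \<Rightarrow> ('v \<Rightarrow> 'v \<Rightarrow> 'v \<Rightarrow> 'v) \<Rightarrow> ('v \<Rightarrow> 'v) \<Rightarrow>
     ('v \<Rightarrow> 'v \<Rightarrow> 'v \<Rightarrow> 'v) \<times> ('v \<Rightarrow> 'v \<Rightarrow> 'v \<Rightarrow> 'v) \<Rightarrow>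
     ('v \<Rightarrow> 'v \<Rightarrow> 'v \<Rightarrow> 'v) \<times> ('v \<Rightarrow> 'v \<Rightarrow> 'v \<Rightarrow> 'v) \<Rightarrow> bool"
  where "generates_linear_deformation scale br1 br2 \<alpha> \<mu> \<omega> \<longleftrightarrow>
    \<mu> \<in> compatible_cochain2 scale \<alpha> \<and> \<omega> \<in> compatible_cochain2 scale \<alpha> \<and>
    (\<forall>t. compatible_hom_lie_triple_system scale
       (deformed_bracket scale br1 (fst \<mu>) (fst \<omega>) t) (deformed_bracket scale br2 (snd \<mu>) (snd \<omega>) t) \<alpha>)"

text \<open>
  Equivalence is stated for pairs of brackets depending on the parameter \<open>t\<close>; the linear
  map \<open>N\<close> does not depend on \<open>t\<close>.
\<close>

definition equivalent_deformations ::
    "('k::field_char_0 \<Rightarrow> 'v::ab_group_add \<Rightarrow> 'v) \<Rightarrow> ('v \<Rightarrow> 'v) \<Rightarrow>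
     ('k \<Rightarrow> 'v \<Rightarrow> 'v \<Rightarrow> 'v \<Rightarrow> 'v) \<times> ('k \<Rightarrow> 'v \<Rightarrow> 'v \<Rightarrow> 'v \<Rightarrow> 'v) \<Rightarrow>
     ('k \<Rightarrow> 'v \<Rightarrow> 'v \<Rightarrow> 'v \<Rightarrow> 'v) \<times> ('k \<Rightarrow> 'v \<Rightarrow> 'v \<Rightarrow> 'v \<Rightarrow> 'v) \<Rightarrow> bool"
  where "equivalent_deformations scale \<alpha> B B' \<longleftrightarrow>
    (\<exists>N. Vector_Spaces.linear scale scale N \<and>
      (\<forall>t. let N\<^sub>t = (\<lambda>x. x + scale t (N x)) in
        \<alpha> \<circ> N\<^sub>t = N\<^sub>t \<circ> \<alpha> \<and>
        (\<forall>a b c. N\<^sub>t (fst B t a b c) = fst B' t (N\<^sub>t a) (N\<^sub>t b) (N\<^sub>t c)) \<and>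
        (\<forall>a b c. N\<^sub>t (snd B t a b c) = snd B' t (N\<^sub>t a) (N\<^sub>t b) (N\<^sub>t c))))"

definition generates_trivial_linear_deformation ::
    "('k::field_char_0 \<Rightarrow> 'v::ab_group_add \<Rightarrow> 'v) \<Rightarrow> ('v \<Rightarrow> 'v \<Rightarrow> 'v \<Rightarrow> 'v) \<Rightarrow> ('v \<Rightarrow> 'v \<Rightarrow> 'v \<Rightarrow> 'v) \<Rightarrow> ('v \<Rightarrow> 'v) \<Rightarrow>
     ('v \<Rightarrow> 'v \<Rightarrow> 'v \<Rightarrow> 'v) \<times> ('v \<Rightarrow> 'v \<Rightarrow> 'v \<Rightarrow> 'v) \<Rightarrow>
     ('v \<Rightarrow> 'v \<Rightarrow> 'v \<Rightarrow> 'v) \<times> ('v \<Rightarrow> 'v \<Rightarrow> 'v \<Rightarrow> 'v) \<Rightarrow> bool"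
  where "generates_trivial_linear_deformation scale br1 br2 \<alpha> \<mu> \<omega> \<longleftrightarrow>
    generates_linear_deformation scale br1 br2 \<alpha> \<mu> \<omega> \<and>
    equivalent_deformations scale \<alpha>
      (deformed_bracket scale br1 (fst \<mu>) (fst \<omega>), deformed_bracket scale br2 (snd \<mu>) (snd \<omega>))
      (\<lambda>t. br1, \<lambda>t. br2)"

end

theory Submission
  imports Defs
begin

text \<open>
  The Nijenhuis identity says exactly that \<open>T = id + t N\<close> intertwines the deformed brackets with
  the original ones. As \<open>T\<close> may fail to be injective, the fundamental and the compatibility identity
  cannot simply be pulled back. However, the defect \<open>p t\<close> of the deformed identity is a polynomial
  in \<open>t\<close> with coefficients in the vector space, and \<open>p t + t N (p t) = 0\<close> for all \<open>t\<close>.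
  Over an infinite field the coefficients satisfy \<open>c 0 = 0\<close> and \<open>c (k + 1) = - N (c k)\<close>, so
  they all vanish. The fundamental identity is treated as compatibility of a bracket with itself, which
  is equivalent to it since 2 is invertible.
\<close>

text \<open>Outer and inner bracket get separate arguments so that the expression can be expanded in
  each of them. On the diagonal its vanishing is the fundamental identity; the vanishing of its
  symmetrisation in \<open>m\<close> and \<open>n\<close> is compatibility.\<close>

definition leibniz_defect ::
    "('v::ab_group_add \<Rightarrow> 'v) \<Rightarrow> ('v \<Rightarrow> 'v \<Rightarrow> 'v \<Rightarrow> 'v) \<Rightarrow> ('v \<Rightarrow> 'v \<Rightarrow> 'v \<Rightarrow> 'v) \<Rightarrow>
     'v \<Rightarrow> 'v \<Rightarrow> 'v \<Rightarrow> 'v \<Rightarrow> 'v \<Rightarrow> 'v"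
  where "leibniz_defect \<alpha> m n a b x y z =
    m (\<alpha> a) (\<alpha> b) (n x y z) - m (n a b x) (\<alpha> y) (\<alpha> z)
    - m (\<alpha> x) (n a b y) (\<alpha> z) - m (\<alpha> x) (\<alpha> y) (n a b z)"

text \<open>The value forced by comparing coefficients of \<open>t\<close> when
  \<open>id + t N\<close> carries the deformed bracket to \<open>m\<close>.\<close>

definition nijenhuis_first :: "('v::ab_group_add \<Rightarrow> 'v) \<Rightarrow> ('v \<Rightarrow> 'v \<Rightarrow> 'v \<Rightarrow> 'v) \<Rightarrow> 'v \<Rightarrow> 'v \<Rightarrow> 'v \<Rightarrow> 'v"
  where "nijenhuis_first N m a b c = m (N a) b c + m a (N b) c + m a b (N c) - N (m a b c)"

text \<open>Likewise forced by the coefficient of \<open>t ^ 2\<close>, in which \<open>N\<close>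
  meets the first-order term.\<close>

definition nijenhuis_second :: "('v::ab_group_add \<Rightarrow> 'v) \<Rightarrow> ('v \<Rightarrow> 'v \<Rightarrow> 'v \<Rightarrow> 'v) \<Rightarrow> 'v \<Rightarrow> 'v \<Rightarrow> 'v \<Rightarrow> 'v"
  where "nijenhuis_second N m a b c =
    m (N a) (N b) c + m (N a) b (N c) + m a (N b) (N c) - N (nijenhuis_first N m a b c)"

abbreviation nijenhuis_deformation ::
    "('k::field_char_0 \<Rightarrow> 'v::ab_group_add \<Rightarrow> 'v) \<Rightarrow> ('v \<Rightarrow> 'v) \<Rightarrow> ('v \<Rightarrow> 'v \<Rightarrow> 'v \<Rightarrow> 'v) \<Rightarrow> 'k \<Rightarrow> 'v \<Rightarrow> 'v \<Rightarrow> 'v \<Rightarrow> 'v"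
  where "nijenhuis_deformation scale N m \<equiv>
    deformed_bracket scale m (nijenhuis_first N m) (nijenhuis_second N m)"

context
  fixes scale :: "'k::field_char_0 \<Rightarrow> 'v::ab_group_add \<Rightarrow> 'v"
  assumes vector_space_scale: "vector_space scale"
begin

interpretation vector_space scale by (fact vector_space_scale)

section \<open>Rewrite rules for linear and trilinear maps\<close>

lemma endomorphism_iff:
  "Vector_Spaces.linear scale scale f \<longleftrightarrow>
    (\<forall>x y. f (x + y) = f x + f y) \<and> (\<forall>r x. f (scale r x) = scale r (f x))"
  by (simp add: Vector_Spaces.linear_iff_module_hom module_hom_iff module_axioms)

lemma endomorphism_simps:
  assumes "Vector_Spaces.linear scale scale f"
  shows "f (x + y) = f x + f y" "f (scale r x) = scale r (f x)" "f 0 = 0"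
    "f (- x) = - f x" "f (x - y) = f x - f y"
proof -
  interpret f: Vector_Spaces.linear scale scale f by (fact assms)
  show "f (x + y) = f x + f y" "f (scale r x) = scale r (f x)" "f 0 = 0"
    "f (- x) = - f x" "f (x - y) = f x - f y"
    by (simp_all add: f.add f.scale f.zero f.neg f.diff)
qed

lemma trilinear_simps:
  assumes "trilinear scale m"
  shows "m (x + y) b c = m x b c + m y b c" "m (scale r x) b c = scale r (m x b c)"
    "m a (x + y) c = m a x c + m a y c" "m a (scale r x) c = scale r (m a x c)"
    "m a b (x + y) = m a b x + m a b y" "m a b (scale r x) = scale r (m a b x)"
  using assms unfolding trilinear_def by (simp_all add: endomorphism_iff)

section \<open>Polynomials in \<open>t\<close> with vector coefficients\<close>

text \<open>Substituting \<open>2 * t\<close> for \<open>t\<close> scales the coefficients by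
  distinct powers of 2, so one degree can be eliminated at a time. Characteristic zero enters
  through the distinctness of these powers.\<close>

lemma polynomial_coefficients_zero:
  assumes "\<And>t. (\<Sum>k\<le>n. scale (t ^ k) (c k)) = 0" and "k \<le> n"
  shows "c k = 0"
  using assms
proof (induction n arbitrary: c k)
  case 0
  then show ?case by simp
next
  case (Suc n)
  \<comment> \<open>The combination \<open>p (2 t) - 2 ^ Suc n p t\<close> annihilates the leading term.\<close>
  define c' where "c' k = scale (2 ^ k - 2 ^ Suc n) (c k)" for k
  have "(\<Sum>k\<le>n. scale (t ^ k) (c' k)) = 0" for t
  proof -
    \<comment> \<open>The extra summand is zero because \<open>c' (Suc n) = 0\<close>.\<close>
    have "(\<Sum>k\<le>n. scale (t ^ k) (c' k)) = (\<Sum>k\<le>Suc n. scale (t ^ k) (c' k))"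
      by (simp add: c'_def)
    also have "\<dots> = (\<Sum>k\<le>Suc n. scale ((2 * t) ^ k) (c k))
        - scale (2 ^ Suc n) (\<Sum>k\<le>Suc n. scale (t ^ k) (c k))"
      unfolding c'_def scale_sum_right sum_subtractf[symmetric]
      by (rule sum.cong) (simp_all add: power_mult_distrib right_diff_distrib scale_left_diff_distrib
          scale_right_diff_distrib mult.commute)
    also have "\<dots> = 0" by (simp only: Suc.prems(1)) simp
    finally show ?thesis .
  qed
  then have c': "c' k = 0" if "k \<le> n" for k using Suc.IH that by blast
  have low: "c k = 0" if "k \<le> n" for k
  proof -
    have "(2::'k) ^ k \<noteq> 2 ^ Suc n"
    proof
      assume "(2::'k) ^ k = 2 ^ Suc n"
      then have "of_nat (2 ^ k) = (of_nat (2 ^ Suc n) :: 'k)" by simp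
      then have "(2::nat) ^ k = 2 ^ Suc n" by (simp only: of_nat_eq_iff)
      then show False using that by (simp only: power_inject_exp)
    qed
    with c'[OF that] show ?thesis by (simp add: c'_def)
  qed
  \<comment> \<open>At \<open>t = 1\<close>, with the lower coefficients gone, the sum is just the
    leading one.\<close>
  moreover have "c (Suc n) = 0" using Suc.prems(1)[of 1] low by simp
  ultimately show ?case using Suc.prems(2) by (metis le_SucE)
qed

text \<open>Cancels \<open>id + t N\<close> without inverting it: for a single \<open>t\<close> this
  map may have a kernel, but it is injective on polynomials in \<open>t\<close>, since its constant
  term is the identity.\<close>

lemma polynomial_zero_of_deformed_identity:
  assumes N: "Vector_Spaces.linear scale scale N"
    and f: "\<And>t. f t = (\<Sum>k\<le>n. scale (t ^ k) (c k))"
    and kernel: "\<And>t. f t + scale t (N (f t)) = 0"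
  shows "f t = 0"
proof -
  interpret N: Vector_Spaces.linear scale scale N by (fact N)
  \<comment> \<open>\<open>d k\<close> is the coefficient of \<open>t ^ k\<close> in
    \<open>f t + t N (f t)\<close>. The guards cover the ends: degree 0 has no \<open>N\<close>
    term, and degree \<open>n + 1\<close> has only \<open>N (c n)\<close>.\<close>
  define d where "d k = (if k \<le> n then c k else 0) + (if k = 0 then 0 else N (c (k - 1)))" for k
  have "(\<Sum>k\<le>Suc n. scale (s ^ k) (d k)) = 0" for s
  proof -
    have "(\<Sum>k\<le>Suc n. scale (s ^ k) (d k)) =
      (\<Sum>k\<le>Suc n. scale (s ^ k) (if k \<le> n then c k else 0))
      + (\<Sum>k\<le>Suc n. scale (s ^ k) (if k = 0 then 0 else N (c (k - 1))))"
      by (simp only: d_def scale_right_distrib sum.distrib)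
    also have "(\<Sum>k\<le>Suc n. scale (s ^ k) (if k \<le> n then c k else 0)) = f s"
      by (simp add: f)
    also have "(\<Sum>k\<le>Suc n. scale (s ^ k) (if k = 0 then 0 else N (c (k - 1)))) = scale s (N (f s))"
      by (simp only: sum.atMost_Suc_shift) (simp add: f N.sum N.scale scale_sum_right)
    finally show ?thesis using kernel by simp
  qed
  then have d: "d k = 0" if "k \<le> Suc n" for k
    using polynomial_coefficients_zero that by blast
  have "c k = 0" if "k \<le> n" for k
    using that
  proof (induction k)
    case 0
    then show ?case using d[of 0] by (simp add: d_def)
  next
    case (Suc k)
    then show ?case using d[of "Suc k"] by (simp add: d_def N.zero)
  qed
  then show ?thesis by (simp add: f)
qed

section \<open>Dependence of the defect on \<open>t\<close> and its transport along
  intertwiners\<close>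

lemma leibniz_defect_deformed_bracket_left:
  "leibniz_defect \<alpha> (deformed_bracket scale m0 m1 m2 t) n a b x y z =
    leibniz_defect \<alpha> m0 n a b x y z + scale t (leibniz_defect \<alpha> m1 n a b x y z)
    + scale (t ^ 2) (leibniz_defect \<alpha> m2 n a b x y z)"
  by (simp add: leibniz_defect_def deformed_bracket_def scale_right_diff_distrib)

lemma leibniz_defect_deformed_bracket_right:
  assumes "trilinear scale m"
  shows "leibniz_defect \<alpha> m (deformed_bracket scale n0 n1 n2 t) a b x y z =
    leibniz_defect \<alpha> m n0 a b x y z + scale t (leibniz_defect \<alpha> m n1 a b x y z)
    + scale (t ^ 2) (leibniz_defect \<alpha> m n2 a b x y z)"
  by (simp add: leibniz_defect_def deformed_bracket_def trilinear_simps[OF assms] scale_right_diff_distrib)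

text \<open>Both brackets are quadratic in \<open>t\<close> and the defect expands in each, whence
  degree 4. Mere existence of coefficients suffices for the cancellation argument.\<close>

lemma leibniz_defect_deformed_bracket_polynomial:
  assumes "trilinear scale m0" "trilinear scale m1" "trilinear scale m2"
  shows "\<exists>c. \<forall>t. leibniz_defect \<alpha> (deformed_bracket scale m0 m1 m2 t)
      (deformed_bracket scale n0 n1 n2 t) a b x y z = (\<Sum>k\<le>4. scale (t ^ k) (c k))"
proof -
  define D where "D m n = leibniz_defect \<alpha> m n a b x y z" for m n
  define c where "c k = [D m0 n0, D m0 n1 + D m1 n0, D m0 n2 + D m1 n1 + D m2 n0,
    D m1 n2 + D m2 n1, D m2 n2] ! k" for k
  have "leibniz_defect \<alpha> (deformed_bracket scale m0 m1 m2 t)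
      (deformed_bracket scale n0 n1 n2 t) a b x y z = (\<Sum>k\<le>4. scale (t ^ k) (c k))" for t
    unfolding leibniz_defect_deformed_bracket_left
      leibniz_defect_deformed_bracket_right[OF assms(1)] leibniz_defect_deformed_bracket_right[OF assms(2)]
      leibniz_defect_deformed_bracket_right[OF assms(3)] D_def[symmetric]
    by (simp add: c_def scale_right_distrib eval_nat_numeral mult.assoc add_ac)
  then show ?thesis by blast
qed

text \<open>Every term nests one bracket in another, so \<open>T\<close> passes through the outer
  bracket, then through \<open>\<alpha>\<close> or the inner bracket. Invertibility of
  \<open>T\<close> is not involved.\<close>

lemma leibniz_defect_intertwined:
  assumes "Vector_Spaces.linear scale scale T" and "\<And>x. \<alpha> (T x) = T (\<alpha> x)"
    and "\<And>a b c. T (m' a b c) = m (T a) (T b) (T c)"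
    and "\<And>a b c. T (n' a b c) = n (T a) (T b) (T c)"
  shows "T (leibniz_defect \<alpha> m' n' a b x y z) = leibniz_defect \<alpha> m n (T a) (T b) (T x) (T y) (T z)"
  by (simp add: leibniz_defect_def endomorphism_simps[OF assms(1)] assms(2-4))

lemma linear_id_add_scale:
  assumes "Vector_Spaces.linear scale scale N"
  shows "Vector_Spaces.linear scale scale (\<lambda>x. x + scale t (N x))"
  by (simp add: endomorphism_iff endomorphism_simps[OF assms] scale_right_distrib mult.commute)

section \<open>Cochain conditions for the Nijenhuis terms and the deformed brackets\<close>

text \<open>Sorting the terms by the variable that carries \<open>N\<close> turns the skew and
  cyclic sums into instances of the same identities for \<open>m\<close>.\<close>

lemma cochain2_nijenhuis_first:
  assumes m: "m \<in> hom_lts_cochain2 scale \<alpha>" and \<alpha>: "Vector_Spaces.linear scale scale \<alpha>"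
    and N: "Vector_Spaces.linear scale scale N" and comm: "\<And>x. \<alpha> (N x) = N (\<alpha> x)"
  shows "nijenhuis_first N m \<in> hom_lts_cochain2 scale \<alpha>"
proof -
  from m have tri: "trilinear scale m" and mult: "\<And>a b c. \<alpha> (m a b c) = m (\<alpha> a) (\<alpha> b) (\<alpha> c)"
    and skew: "\<And>a b c. m a b c + m b a c = 0" and cyc: "\<And>a b c. m a b c + m b c a + m c a b = 0"
    by (auto simp: hom_lts_cochain2_def)
  have "trilinear scale (nijenhuis_first N m)"
    unfolding trilinear_def endomorphism_iff nijenhuis_first_def
    by (simp add: trilinear_simps[OF tri] endomorphism_simps[OF N] algebra_simps)
  moreover have "\<alpha> (nijenhuis_first N m a b c) = nijenhuis_first N m (\<alpha> a) (\<alpha> b) (\<alpha> c)" for a b c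
    by (simp add: nijenhuis_first_def endomorphism_simps[OF \<alpha>] mult comm)
  moreover have "nijenhuis_first N m a b c + nijenhuis_first N m b a c = 0" for a b c
  proof -
    have "nijenhuis_first N m a b c + nijenhuis_first N m b a c =
      (m (N a) b c + m b (N a) c) + (m a (N b) c + m (N b) a c)
      + (m a b (N c) + m b a (N c)) - N (m a b c + m b a c)"
      by (simp add: nijenhuis_first_def endomorphism_simps[OF N] algebra_simps)
    then show ?thesis by (simp add: skew endomorphism_simps[OF N])
  qed
  moreover have "nijenhuis_first N m a b c + nijenhuis_first N m b c a + nijenhuis_first N m c a b = 0"
    for a b c
  proof -
    have "nijenhuis_first N m a b c + nijenhuis_first N m b c a + nijenhuis_first N m c a b =
      (m (N a) b c + m b c (N a) + m c (N a) b) + (m a (N b) c + m (N b) c a + m c a (N b))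
      + (m a b (N c) + m b (N c) a + m (N c) a b) - N (m a b c + m b c a + m c a b)"
      by (simp add: nijenhuis_first_def endomorphism_simps[OF N] algebra_simps)
    then show ?thesis by (simp add: cyc endomorphism_simps[OF N])
  qed
  ultimately show ?thesis by (simp add: hom_lts_cochain2_def)
qed

text \<open>Now the terms are sorted by the pair of variables carrying \<open>N\<close>; the
  correction under the outer \<open>N\<close> is handled by the conditions already known for
  \<open>nijenhuis_first N m\<close>.\<close>

lemma cochain2_nijenhuis_second:
  assumes m: "m \<in> hom_lts_cochain2 scale \<alpha>" and \<alpha>: "Vector_Spaces.linear scale scale \<alpha>"
    and N: "Vector_Spaces.linear scale scale N" and comm: "\<And>x. \<alpha> (N x) = N (\<alpha> x)"
  shows "nijenhuis_second N m \<in> hom_lts_cochain2 scale \<alpha>"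
proof -
  let ?\<mu> = "nijenhuis_first N m"
  from m have tri: "trilinear scale m" and mult: "\<And>a b c. \<alpha> (m a b c) = m (\<alpha> a) (\<alpha> b) (\<alpha> c)"
    and skew: "\<And>a b c. m a b c + m b a c = 0" and cyc: "\<And>a b c. m a b c + m b c a + m c a b = 0"
    by (auto simp: hom_lts_cochain2_def)
  from cochain2_nijenhuis_first[OF assms]
  have tri': "trilinear scale ?\<mu>" and mult': "\<And>a b c. \<alpha> (?\<mu> a b c) = ?\<mu> (\<alpha> a) (\<alpha> b) (\<alpha> c)"
    and skew': "\<And>a b c. ?\<mu> a b c + ?\<mu> b a c = 0" and cyc': "\<And>a b c. ?\<mu> a b c + ?\<mu> b c a + ?\<mu> c a b = 0"
    by (auto simp: hom_lts_cochain2_def)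
  have "trilinear scale (nijenhuis_second N m)"
    unfolding trilinear_def endomorphism_iff nijenhuis_second_def
    by (simp add: trilinear_simps[OF tri] trilinear_simps[OF tri'] endomorphism_simps[OF N] algebra_simps)
  moreover have "\<alpha> (nijenhuis_second N m a b c) = nijenhuis_second N m (\<alpha> a) (\<alpha> b) (\<alpha> c)" for a b c
    by (simp add: nijenhuis_second_def endomorphism_simps[OF \<alpha>] mult mult' comm)
  moreover have "nijenhuis_second N m a b c + nijenhuis_second N m b a c = 0" for a b c
  proof -
    have "nijenhuis_second N m a b c + nijenhuis_second N m b a c =
      (m (N a) (N b) c + m (N b) (N a) c) + (m (N a) b (N c) + m b (N a) (N c))
      + (m a (N b) (N c) + m (N b) a (N c)) - N (?\<mu> a b c + ?\<mu> b a c)"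
      by (simp add: nijenhuis_second_def endomorphism_simps[OF N] algebra_simps)
    then show ?thesis by (simp add: skew skew' endomorphism_simps[OF N])
  qed
  moreover have "nijenhuis_second N m a b c + nijenhuis_second N m b c a + nijenhuis_second N m c a b = 0"
    for a b c
  proof -
    have "nijenhuis_second N m a b c + nijenhuis_second N m b c a + nijenhuis_second N m c a b =
      (m (N a) (N b) c + m (N b) c (N a) + m c (N a) (N b))
      + (m (N a) b (N c) + m b (N c) (N a) + m (N c) (N a) b)
      + (m a (N b) (N c) + m (N b) (N c) a + m (N c) a (N b)) - N (?\<mu> a b c + ?\<mu> b c a + ?\<mu> c a b)"
      by (simp add: nijenhuis_second_def endomorphism_simps[OF N] algebra_simps)
    then show ?thesis by (simp add: cyc cyc' endomorphism_simps[OF N])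
  qed
  ultimately show ?thesis by (simp add: hom_lts_cochain2_def)
qed

text \<open>The cochain conditions are linear in the bracket, \<open>\<alpha>\<close> being linear,
  so they survive linear combinations.\<close>

lemma cochain2_deformed_bracket:
  assumes \<alpha>: "Vector_Spaces.linear scale scale \<alpha>"
    and "m0 \<in> hom_lts_cochain2 scale \<alpha>" "m1 \<in> hom_lts_cochain2 scale \<alpha>" "m2 \<in> hom_lts_cochain2 scale \<alpha>"
  shows "deformed_bracket scale m0 m1 m2 t \<in> hom_lts_cochain2 scale \<alpha>"
proof -
  let ?m = "deformed_bracket scale m0 m1 m2 t"
  have tri: "trilinear scale m" and mult: "\<And>a b c. \<alpha> (m a b c) = m (\<alpha> a) (\<alpha> b) (\<alpha> c)"
    and skew: "\<And>a b c. m a b c + m b a c = 0" and cyc: "\<And>a b c. m a b c + m b c a + m c a b = 0"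
    if "m \<in> hom_lts_cochain2 scale \<alpha>" for m
    using that by (auto simp: hom_lts_cochain2_def)
  note tri = assms(2-4)[THEN tri] and mult = assms(2-4)[THEN mult]
    and skew = assms(2-4)[THEN skew] and cyc = assms(2-4)[THEN cyc]
  have "trilinear scale ?m"
    unfolding trilinear_def endomorphism_iff deformed_bracket_def
    by (simp add: trilinear_simps[OF tri(1)] trilinear_simps[OF tri(2)] trilinear_simps[OF tri(3)]
        algebra_simps)
  moreover have "\<alpha> (?m a b c) = ?m (\<alpha> a) (\<alpha> b) (\<alpha> c)" for a b c
    by (simp add: deformed_bracket_def endomorphism_simps[OF \<alpha>] mult)
  moreover have "?m a b c + ?m b a c = 0" for a b c
  proof -
    have "?m a b c + ?m b a c = (m0 a b c + m0 b a c) + scale t (m1 a b c + m1 b a c)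
        + scale (t ^ 2) (m2 a b c + m2 b a c)"
      by (simp add: deformed_bracket_def algebra_simps)
    then show ?thesis by (simp add: skew)
  qed
  moreover have "?m a b c + ?m b c a + ?m c a b = 0" for a b c
  proof -
    have "?m a b c + ?m b c a + ?m c a b = (m0 a b c + m0 b c a + m0 c a b)
        + scale t (m1 a b c + m1 b c a + m1 c a b) + scale (t ^ 2) (m2 a b c + m2 b c a + m2 c a b)"
      by (simp add: deformed_bracket_def algebra_simps)
    then show ?thesis by (simp add: cyc)
  qed
  ultimately show ?thesis by (simp add: hom_lts_cochain2_def)
qed

section \<open>The intertwining identity and the vanishing of deformed defects\<close>

text \<open>Both sides are cubic in \<open>t\<close>. Degrees 1 and 2 agree by the choice of the two
  Nijenhuis terms; degree 3 is the Nijenhuis identity.\<close>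

lemma nijenhuis_deformation_intertwined:
  assumes tri: "trilinear scale m" and "nijenhuis_operator scale m \<alpha> N"
  shows "nijenhuis_deformation scale N m t a b c + scale t (N (nijenhuis_deformation scale N m t a b c))
    = m (a + scale t (N a)) (b + scale t (N b)) (c + scale t (N c))"
proof -
  from assms(2) have N: "Vector_Spaces.linear scale scale N"
    and nij: "m (N a) (N b) (N c) =
        N (m (N a) (N b) c + m (N a) b (N c) + m a (N b) (N c))
      - (N ^^ 2) (m (N a) b c + m a (N b) c + m a b (N c)) + (N ^^ 3) (m a b c)"
    by (simp_all add: nijenhuis_operator_def)
  let ?\<mu> = "nijenhuis_first N m a b c" and ?\<omega> = "nijenhuis_second N m a b c"
  have first: "m (N a) b c + m a (N b) c + m a b (N c) = ?\<mu> + N (m a b c)"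
    by (simp add: nijenhuis_first_def)
  have second: "m (N a) (N b) c + m (N a) b (N c) + m a (N b) (N c) = ?\<omega> + N ?\<mu>"
    by (simp add: nijenhuis_second_def)
  \<comment> \<open>After substituting \<open>first\<close> and \<open>second\<close>, the terms in
    \<open>N ^^ 2\<close> and \<open>N ^^ 3\<close> cancel.\<close>
  have third: "m (N a) (N b) (N c) = N ?\<omega>"
    unfolding nij first second by (simp add: endomorphism_simps[OF N] eval_nat_numeral)
  have "m (a + scale t (N a)) (b + scale t (N b)) (c + scale t (N c)) = m a b c
      + scale t (m (N a) b c + m a (N b) c + m a b (N c))
      + scale (t ^ 2) (m (N a) (N b) c + m (N a) b (N c) + m a (N b) (N c))
      + scale (t ^ 3) (m (N a) (N b) (N c))"
    by (simp add: trilinear_simps[OF tri] eval_nat_numeral scale_right_distrib mult.assoc add_ac)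
  also have "\<dots> = m a b c + scale t (?\<mu> + N (m a b c)) + scale (t ^ 2) (?\<omega> + N ?\<mu>)
      + scale (t ^ 3) (N ?\<omega>)"
    by (simp only: first second third)
  finally show ?thesis
    by (simp add: deformed_bracket_def endomorphism_simps[OF N] eval_nat_numeral scale_right_distrib add_ac)
qed

text \<open>Serves both identities: two different brackets give compatibility, and
  \<open>n = m\<close> gives twice the fundamental identity.\<close>

lemma symmetric_leibniz_defect_nijenhuis_deformation:
  assumes \<alpha>: "Vector_Spaces.linear scale scale \<alpha>"
    and m: "m \<in> hom_lts_cochain2 scale \<alpha>" "nijenhuis_operator scale m \<alpha> N"
    and n: "n \<in> hom_lts_cochain2 scale \<alpha>" "nijenhuis_operator scale n \<alpha> N"
    and zero: "\<And>a b x y z. leibniz_defect \<alpha> m n a b x y z + leibniz_defect \<alpha> n m a b x y z = 0"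
  shows "leibniz_defect \<alpha> (nijenhuis_deformation scale N m t) (nijenhuis_deformation scale N n t) a b x y z
    + leibniz_defect \<alpha> (nijenhuis_deformation scale N n t) (nijenhuis_deformation scale N m t) a b x y z = 0"
proof -
  let ?m = "nijenhuis_deformation scale N m" and ?n = "nijenhuis_deformation scale N n"
  let ?f = "\<lambda>t. leibniz_defect \<alpha> (?m t) (?n t) a b x y z + leibniz_defect \<alpha> (?n t) (?m t) a b x y z"
  from m(2) have N: "Vector_Spaces.linear scale scale N" and comm: "\<alpha> (N x) = N (\<alpha> x)" for x
    by (simp_all add: nijenhuis_operator_def fun_eq_iff)
  have tri: "trilinear scale \<mu>" "trilinear scale (nijenhuis_first N \<mu>)"
      "trilinear scale (nijenhuis_second N \<mu>)" if "\<mu> \<in> hom_lts_cochain2 scale \<alpha>" for \<mu>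
    using that cochain2_nijenhuis_first[OF that \<alpha> N comm] cochain2_nijenhuis_second[OF that \<alpha> N comm]
    by (simp_all add: hom_lts_cochain2_def)
  obtain c where c: "\<And>t. leibniz_defect \<alpha> (?m t) (?n t) a b x y z = (\<Sum>k\<le>4. scale (t ^ k) (c k))"
    using leibniz_defect_deformed_bracket_polynomial[OF tri[OF m(1)]] by blast
  obtain d where d: "\<And>t. leibniz_defect \<alpha> (?n t) (?m t) a b x y z = (\<Sum>k\<le>4. scale (t ^ k) (d k))"
    using leibniz_defect_deformed_bracket_polynomial[OF tri[OF n(1)]] by blast
  show ?thesis
  proof (rule polynomial_zero_of_deformed_identity[OF N, where f = ?f and n = 4 and c = "\<lambda>k. c k + d k"])
    show "?f t = (\<Sum>k\<le>4. scale (t ^ k) (c k + d k))" for t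
      by (simp only: c d scale_right_distrib sum.distrib)
    show "?f t + scale t (N (?f t)) = 0" for t
    proof -
      let ?T = "\<lambda>x. x + scale t (N x)"
      have T: "Vector_Spaces.linear scale scale ?T" by (rule linear_id_add_scale[OF N])
      have comm_T: "\<alpha> (?T x) = ?T (\<alpha> x)" for x by (simp add: endomorphism_simps[OF \<alpha>] comm)
      note mT = nijenhuis_deformation_intertwined[OF tri(1)[OF m(1)] m(2), of t]
        and nT = nijenhuis_deformation_intertwined[OF tri(1)[OF n(1)] n(2), of t]
      \<comment> \<open>The kernel condition says that \<open>?T\<close> kills \<open>?f t\<close>.
        It carries the sum to the undeformed one at the arguments \<open>?T a\<close>, ...,
        \<open>?T z\<close>, where \<open>zero\<close> applies.\<close>
      have "?T (?f t) = ?T (leibniz_defect \<alpha> (?m t) (?n t) a b x y z)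
          + ?T (leibniz_defect \<alpha> (?n t) (?m t) a b x y z)"
        by (rule endomorphism_simps(1)[OF T])
      also have "\<dots> = leibniz_defect \<alpha> m n (?T a) (?T b) (?T x) (?T y) (?T z)
          + leibniz_defect \<alpha> n m (?T a) (?T b) (?T x) (?T y) (?T z)"
        by (simp only: leibniz_defect_intertwined[where T = ?T and \<alpha> = \<alpha> and m' = "?m t" and m = m
              and n' = "?n t" and n = n, OF T comm_T mT nT]
            leibniz_defect_intertwined[where T = ?T and \<alpha> = \<alpha> and m' = "?n t" and m = n
              and n' = "?m t" and n = m, OF T comm_T nT mT])
      also have "\<dots> = 0" by (rule zero)
      finally show ?thesis .
    qed
  qed
qed

section \<open>The axioms in terms of cochains and defects\<close>

lemma hom_lie_triple_system_iff:
  "hom_lie_triple_system scale m \<alpha> \<longleftrightarrow>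
    Vector_Spaces.linear scale scale \<alpha> \<and> m \<in> hom_lts_cochain2 scale \<alpha> \<and>
    (\<forall>a b x y z. leibniz_defect \<alpha> m m a b x y z = 0)"
proof -
  \<comment> \<open>The axiom and the cochain condition list the cyclic permutations in opposite
    orders.\<close>
  have cyc: "m a b c + m c a b + m b c a = m a b c + m b c a + m c a b" for a b c
    by (simp only: add_ac)
  have "leibniz_defect \<alpha> m m a b x y z = 0 \<longleftrightarrow> m (\<alpha> a) (\<alpha> b) (m x y z) =
      m (m a b x) (\<alpha> y) (\<alpha> z) + m (\<alpha> x) (m a b y) (\<alpha> z) + m (\<alpha> x) (\<alpha> y) (m a b z)" for a b x y z
    by (simp add: leibniz_defect_def diff_eq_eq add_ac)
  then show ?thesis
    unfolding hom_lie_triple_system_def hom_lie_triple_system_axioms_def hom_lts_cochain2_def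
      mem_Collect_eq cyc
    using vector_space_scale by blast
qed

lemma compatible_hom_lie_triple_system_iff:
  "compatible_hom_lie_triple_system scale m n \<alpha> \<longleftrightarrow>
    hom_lie_triple_system scale m \<alpha> \<and> hom_lie_triple_system scale n \<alpha> \<and>
    (\<forall>a b x y z. leibniz_defect \<alpha> m n a b x y z + leibniz_defect \<alpha> n m a b x y z = 0)"
  unfolding compatible_hom_lie_triple_system_def compatible_hom_lie_triple_system_axioms_def
  by (simp add: leibniz_defect_def algebra_simps)

lemma add_self_eq_0_iff: "(v::'v) + v = 0 \<longleftrightarrow> v = 0"
proof -
  have "v + v = scale 2 v" using scale_left_distrib[of 1 1 v] by simp
  then show ?thesis by simp
qed

text \<open>The diagonal case of the symmetrised vanishing: the defect added to itself is zero,
  hence so is the defect.\<close>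

lemma hom_lie_triple_system_nijenhuis_deformation:
  assumes "hom_lie_triple_system scale m \<alpha>" and "nijenhuis_operator scale m \<alpha> N"
  shows "hom_lie_triple_system scale (nijenhuis_deformation scale N m t) \<alpha>"
proof -
  from assms(1) have \<alpha>: "Vector_Spaces.linear scale scale \<alpha>" and m: "m \<in> hom_lts_cochain2 scale \<alpha>"
    and zero: "\<And>a b x y z. leibniz_defect \<alpha> m m a b x y z = 0"
    by (simp_all add: hom_lie_triple_system_iff)
  from assms(2) have N: "Vector_Spaces.linear scale scale N" and comm: "\<alpha> (N x) = N (\<alpha> x)" for x
    by (simp_all add: nijenhuis_operator_def fun_eq_iff)
  show ?thesis
    unfolding hom_lie_triple_system_iff
    using \<alpha> cochain2_deformed_bracket[OF \<alpha> m cochain2_nijenhuis_first[OF m \<alpha> N comm]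
        cochain2_nijenhuis_second[OF m \<alpha> N comm]]
      symmetric_leibniz_defect_nijenhuis_deformation[OF \<alpha> m assms(2) m assms(2)]
    by (simp add: zero add_self_eq_0_iff)
qed

end

theorem proposition4p6:
  fixes scale :: "'k::field_char_0 \<Rightarrow> 'v::ab_group_add \<Rightarrow> 'v"
    and br1 br2 \<mu>1 \<mu>2 \<omega>1 \<omega>2 :: "'v \<Rightarrow> 'v \<Rightarrow> 'v \<Rightarrow> 'v"
    and \<alpha> N :: "'v \<Rightarrow> 'v"
  assumes "compatible_hom_lie_triple_system scale br1 br2 \<alpha>"
    and "compatible_nijenhuis_operator scale br1 br2 \<alpha> N"
    and "\<And>a b c. \<mu>1 a b c = br1 (N a) b c + br1 a (N b) c + br1 a b (N c) - N (br1 a b c)"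
    and "\<And>a b c. \<mu>2 a b c = br2 (N a) b c + br2 a (N b) c + br2 a b (N c) - N (br2 a b c)"
    and "\<And>a b c. \<omega>1 a b c = br1 (N a) (N b) c + br1 (N a) b (N c) + br1 a (N b) (N c) - N (\<mu>1 a b c)"
    and "\<And>a b c. \<omega>2 a b c = br2 (N a) (N b) c + br2 (N a) b (N c) + br2 a (N b) (N c) - N (\<mu>2 a b c)"
  shows "generates_trivial_linear_deformation scale br1 br2 \<alpha> (\<mu>1, \<mu>2) (\<omega>1, \<omega>2)"
proof -
  interpret compatible_hom_lie_triple_system scale br1 br2 \<alpha> by (fact assms(1))
  note vs = first.vector_space_axioms
  have \<mu>: "\<mu>1 = nijenhuis_first N br1" "\<mu>2 = nijenhuis_first N br2"
    by (simp_all add: fun_eq_iff assms(3,4) nijenhuis_first_def)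
  have \<omega>: "\<omega>1 = nijenhuis_second N br1" "\<omega>2 = nijenhuis_second N br2"
    by (simp_all add: fun_eq_iff assms(5,6) nijenhuis_second_def \<mu>)
  from assms(2) have nij: "nijenhuis_operator scale br1 \<alpha> N" "nijenhuis_operator scale br2 \<alpha> N"
    by (simp_all add: compatible_nijenhuis_operator_def)
  from nij(1) have N: "Vector_Spaces.linear scale scale N" and comm: "\<alpha> (N x) = N (\<alpha> x)" for x
    by (simp_all add: nijenhuis_operator_def fun_eq_iff)
  note \<alpha> = first.linear_twist
  have br: "br1 \<in> hom_lts_cochain2 scale \<alpha>" "br2 \<in> hom_lts_cochain2 scale \<alpha>"
    and zero: "\<And>a b x y z. leibniz_defect \<alpha> br1 br2 a b x y z + leibniz_defect \<alpha> br2 br1 a b x y z = 0"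
    using assms(1) by (simp_all add: compatible_hom_lie_triple_system_iff[OF vs] hom_lie_triple_system_iff[OF vs])
  \<comment> \<open>The diagonal cases make each deformed bracket a Hom-Lie triple system; the mixed
    case makes the two compatible.\<close>
  have "compatible_hom_lie_triple_system scale (nijenhuis_deformation scale N br1 t)
      (nijenhuis_deformation scale N br2 t) \<alpha>" for t
    using hom_lie_triple_system_nijenhuis_deformation[OF vs first.hom_lie_triple_system_axioms nij(1)]
      hom_lie_triple_system_nijenhuis_deformation[OF vs second.hom_lie_triple_system_axioms nij(2)]
      symmetric_leibniz_defect_nijenhuis_deformation[OF vs \<alpha> br(1) nij(1) br(2) nij(2) zero]
    by (simp add: compatible_hom_lie_triple_system_iff[OF vs])
  then have "generates_linear_deformation scale br1 br2 \<alpha> (\<mu>1, \<mu>2) (\<omega>1, \<omega>2)"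
    using cochain2_nijenhuis_first[OF vs _ \<alpha> N comm] cochain2_nijenhuis_second[OF vs _ \<alpha> N comm] br
    by (simp add: generates_linear_deformation_def compatible_cochain2_def \<mu> \<omega>)
  moreover have "equivalent_deformations scale \<alpha>
      (deformed_bracket scale br1 \<mu>1 \<omega>1, deformed_bracket scale br2 \<mu>2 \<omega>2) (\<lambda>t. br1, \<lambda>t. br2)"
    unfolding equivalent_deformations_def Let_def \<mu> \<omega>
    using N nijenhuis_deformation_intertwined[OF vs first.trilinear_br nij(1)]
      nijenhuis_deformation_intertwined[OF vs second.trilinear_br nij(2)]
    \<comment> \<open>The Nijenhuis operator itself is the witness, the same for every
      \<open>t\<close>.\<close>
    by (intro exI[of _ N]) (simp add: fun_eq_iff endomorphism_simps[OF vs \<alpha>] comm)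
  ultimately show ?thesis
    by (simp add: generates_trivial_linear_deformation_def)
qed

end
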